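(* For every $0<\epsilon\le 1$ and every integer $n\ge 2$, the function $$\psi(\xi)=\big(s_n(\xi)\big)^{\epsilon}=\underbrace{\big(\ln(1+\ln(1+\ln(\cdots\ln(1+|\xi|))))\big)^{\epsilon}}_{n\ \text{times}},\qquad \xi\in\mathbb R,$$ is the Lévy symbol of a one-dimensional Lévy process which has a transition density.
   Context: The Lévy symbol $\eta$ of a one-dimensional Lévy process $X_t$ with distributions $P_t$ is defined by $\int_{\mathbb R}e^{i\xi y}P_t(dy)=e^{-t\eta(\xi)}$. A transition density of $X_t$ is a family $p_t$, $t>0$, with $P_t(dx)=p_t(x)\,dx$. Notation: $s_1(\xi)=\ln(1+|\xi|)$ and $s_n(\xi)=\ln(1+s_{n-1}(\xi))$ for $n\ge 2$. *)

theory Defs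
  imports "HOL-Probability.Probability"
begin

text \<open>
  A one-dimensional process indexed by time in \<open>[0, \<infinity>)\<close>; the values \<open>X t\<close> for \<open>t < 0\<close> play no
  role. Path regularity is imposed as continuity in probability (in the presence of the other
  axioms this is equivalent to the existence of a modification with cadlag paths).
\<close>

locale levy_process = prob_space M for M :: "'w measure" +
  fixes X :: "real \<Rightarrow> 'w \<Rightarrow> real"
  assumes random_variable: "\<And>t. t \<ge> 0 \<Longrightarrow> X t \<in> borel_measurable M"
    and starts_at_zero: "AE \<omega> in M. X 0 \<omega> = 0"
    and independent_increments:
      "\<And>(m :: nat) (\<tau> :: nat \<Rightarrow> real). 0 \<le> \<tau> 0 \<Longrightarrow> (\<And>i. i < m \<Longrightarrow> \<tau> i \<le> \<tau> (Suc i)) \<Longrightarrow>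
         indep_vars (\<lambda>_. borel) (\<lambda>i \<omega>. X (\<tau> (Suc i)) \<omega> - X (\<tau> i) \<omega>) {..<m}"
    and stationary_increments:
      "\<And>s t. 0 \<le> s \<Longrightarrow> s \<le> t \<Longrightarrow>
         distr M borel (\<lambda>\<omega>. X t \<omega> - X s \<omega>) = distr M borel (X (t - s))"
    and continuous_in_probability:
      "\<And>s \<delta>. 0 \<le> s \<Longrightarrow> 0 < \<delta> \<Longrightarrow>
         ((\<lambda>t. prob {\<omega> \<in> space M. \<bar>X t \<omega> - X s \<omega>\<bar> > \<delta>}) \<longlongrightarrow> 0) (at s within {0..})"

text \<open>Sign convention: the characteristic function of \<open>X t\<close> is \<open>exp (- t * \<eta> \<xi>)\<close>.\<close>

definition is_levy_symbol :: "'w measure \<Rightarrow> (real \<Rightarrow> 'w \<Rightarrow> real) \<Rightarrow> (real \<Rightarrow> complex) \<Rightarrow> bool" where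
  "is_levy_symbol M X \<eta> \<longleftrightarrow>
     (\<forall>t\<ge>0. \<forall>\<xi>. char (distr M borel (X t)) \<xi> = exp (- (complex_of_real t * \<eta> \<xi>)))"

definition is_transition_density ::
    "'w measure \<Rightarrow> (real \<Rightarrow> 'w \<Rightarrow> real) \<Rightarrow> (real \<Rightarrow> real \<Rightarrow> real) \<Rightarrow> bool" where
  "is_transition_density M X p \<longleftrightarrow>
     (\<forall>t>0. (\<forall>x. 0 \<le> p t x) \<and> distributed M lborel (X t) (\<lambda>x. ennreal (p t x)))"

text \<open>For \<open>n \<ge> 1\<close> this is the function written \<open>s\<^sub>n\<close>; the case \<open>0\<close> only starts the recursion.\<close>

primrec iter_log :: "nat \<Rightarrow> real \<Rightarrow> real" where
  "iter_log 0 \<xi> = \<bar>\<xi>\<bar>"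
| "iter_log (Suc n) \<xi> = ln (1 + iter_log n \<xi>)"

end

theory Submission
  imports Defs
begin

text \<open>
  For \<open>t > 0\<close> the function \<open>r \<mapsto> exp (- t * f r)\<close> with \<open>f = (s\<^sub>n)\<^sup>\<epsilon>\<close> is convex and decreases from 1 to 0
  on the half-line, because \<open>f\<close> is a composition of increasing concave functions, vanishes at 0 and
  is unbounded. Polya's criterion therefore makes \<open>exp (- t * f \<bar>\<xi>\<bar>)\<close> the characteristic function
  of an absolutely continuous law. All functions involved are twice continuously differentiable
  on \<open>(0, \<infinity>)\<close>, so the density can be written down: a convex \<open>g\<close> vanishing at infinity is
  the mixture \<open>g r = \<integral> max 0 (s - r) * g'' s ds\<close> of tent functions
  (\<open>has_bochner_integral_tent_mixture\<close>), and a tent is the Fourier transform of the nonnegative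
  Fejer kernel \<open>(1 - cos (s * x)) / (\<pi> * x\<^sup>2)\<close> (\<open>has_bochner_integral_fejer\<close>); hence
  \<open>\<integral> g'' s * (1 - cos (s * x)) / (\<pi> * x\<^sup>2) ds\<close>, integrated over \<open>s > 0\<close>, is a density with
  characteristic function \<open>g \<bar>\<xi>\<bar>\<close> (\<open>char_polya\<close>).

  It remains to pass from a family of laws \<open>\<mu> t\<close> with characteristic functions
  \<open>exp (- t * \<psi> \<xi>)\<close> to a process. For a finite set \<open>H\<close> of times one takes independent increments, the
  one ending at \<open>t \<in> H\<close> having law \<open>\<mu> (t - t')\<close> with \<open>t'\<close> the predecessor of \<open>t\<close>, and lets \<open>fdd H\<close> be the
  joint law of the partial sums. Thinning \<open>H\<close> merges consecutive increments; sums over disjoint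
  blocks stay independent and have the right laws by uniqueness of characteristic functions
  (\<open>distr_block_sums\<close>), so the \<open>fdd H\<close> are consistent and Kolmogorov's extension theorem yields a
  measure on paths. The same block sums give independence and stationarity of the
  increments, and Levy's continuity theorem gives continuity in probability.
\<close>

section \<open>The Fejer kernel\<close>

lemma has_bochner_integral_FTC_halfline:
  fixes f F :: "real \<Rightarrow> real"
  assumes D: "\<And>x. a < x \<Longrightarrow> (F has_real_derivative f x) (at x)"
    and C: "\<And>x. a < x \<Longrightarrow> isCont f x"
    and nonneg: "\<And>x. a < x \<Longrightarrow> 0 \<le> f x"
    and A: "(F \<longlongrightarrow> A) (at_right a)" and B: "(F \<longlongrightarrow> B) at_top"
  shows "has_bochner_integral lborel (\<lambda>x. indicator {a<..} x * f x) (B - A)"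
proof -
  have "set_integrable lborel (einterval (ereal a) \<infinity>) f" "(LBINT x=ereal a..\<infinity>. f x) = B - A"
    by (rule interval_integral_FTC_nonneg[where F = F and A = A and B = B];
        use D C nonneg A B in \<open>simp add: ereal_tendsto_simps\<close>)+
  then show ?thesis
    by (simp add: has_bochner_integral_iff set_integrable_def interval_lebesgue_integral_def
        set_lebesgue_integral_def)
qed

text \<open>
  The function \<open>x \<mapsto> a * Si (a * x) - (1 - cos (a * x)) / x\<close> is an antiderivative of the integrand, and
  \<open>Si\<close> tends to \<open>\<pi> / 2\<close>.
\<close>

lemma has_bochner_integral_one_minus_cos_pos:
  fixes a :: real
  assumes "0 < a"
  shows "has_bochner_integral lborel (\<lambda>x. (1 - cos (a * x)) / x\<^sup>2) (pi * a)"
proof -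
  let ?F = "\<lambda>x. a * Si (a * x) - (1 - cos (a * x)) / x"
  have "has_bochner_integral lborel
    (\<lambda>x. indicator {0<..} x * ((1 - cos (a * x)) / x\<^sup>2)) (a * (pi / 2) - 0 - a * Si (a * 0))"
  proof (rule has_bochner_integral_FTC_halfline)
    fix x :: real assume x: "0 < x"
    have "((\<lambda>x. Si (a * x)) has_real_derivative sinc (a * x) * a) (at x)"
      using DERIV_chain2[OF DERIV_Si, of "\<lambda>x. a * x" a x UNIV]
      by (auto intro!: derivative_eq_intros)
    then show "(?F has_real_derivative (1 - cos (a * x)) / x\<^sup>2) (at x)"
      using x assms
      by (auto intro!: derivative_eq_intros simp: field_simps power2_eq_square)
  next
    fix x :: real assume "0 < x"
    then show "isCont (\<lambda>x. (1 - cos (a * x)) / x\<^sup>2) x"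
      by (auto intro!: continuous_intros)
  next
    have 1: "((\<lambda>x. a * Si (a * x)) \<longlongrightarrow> a * Si (a * 0)) (at_right 0)"
      by (intro tendsto_intros isCont_tendsto_compose[OF isCont_Si])
    have 2: "((\<lambda>x. (1 - cos (a * x)) / x) \<longlongrightarrow> 0) (at_right 0)"
      using assms by real_asymp
    show "(?F \<longlongrightarrow> a * Si (a * 0)) (at_right 0)"
      using tendsto_diff[OF 1 2] by simp
  next
    have 1: "((\<lambda>x. a * Si (a * x)) \<longlongrightarrow> a * (pi / 2)) at_top"
      using assms
      by (intro tendsto_intros filterlim_compose[OF Si_at_top]
          filterlim_tendsto_pos_mult_at_top[OF tendsto_const _ filterlim_ident])
    have 2: "((\<lambda>x. (1 - cos (a * x)) / x) \<longlongrightarrow> 0) at_top"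
      by real_asymp
    show "(?F \<longlongrightarrow> a * (pi / 2) - 0) at_top"
      by (rule tendsto_diff[OF 1 2])
  qed simp_all
  then have "has_bochner_integral lborel (\<lambda>x. indicator {0<..} x * ((1 - cos (a * x)) / x\<^sup>2)) (a * (pi / 2))"
    by (simp add: Si_def flip: zero_ereal_def)
  then have "has_bochner_integral lborel (\<lambda>x. indicator {0..} x *\<^sub>R ((1 - cos (a * x)) / x\<^sup>2)) (a * (pi / 2))"
    by (rule has_bochner_integral_cong[THEN iffD1, rotated -1]) (auto simp: indicator_def)
  from has_bochner_integral_even_function[OF this] show ?thesis
    by (simp add: mult.commute)
qed

lemma has_bochner_integral_one_minus_cos:
  "has_bochner_integral lborel (\<lambda>x::real. (1 - cos (a * x)) / x\<^sup>2) (pi * \<bar>a\<bar>)"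
  using has_bochner_integral_one_minus_cos_pos[of "\<bar>a\<bar>"]
  by (cases "a = 0") (auto simp: abs_if)

text \<open>
  The Fourier transform of the Fejer kernel is a tent. By the product formula for cosines the integrand
  is a combination of three functions \<open>(1 - cos (a * x)) / x\<^sup>2\<close>.
\<close>

lemma has_bochner_integral_fejer:
  fixes s :: real
  assumes "0 \<le> s"
  shows "has_bochner_integral lborel
           (\<lambda>x. cos (\<xi> * x) * ((1 - cos (s * x)) / (pi * x\<^sup>2))) (max 0 (s - \<bar>\<xi>\<bar>))"
proof -
  have "has_bochner_integral lborel
      (\<lambda>x. (1 / (2 * pi)) * ((1 - cos ((s + \<xi>) * x)) / x\<^sup>2 + (1 - cos ((s - \<xi>) * x)) / x\<^sup>2
             - 2 * ((1 - cos (\<xi> * x)) / x\<^sup>2)))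
      ((1 / (2 * pi)) * (pi * \<bar>s + \<xi>\<bar> + pi * \<bar>s - \<xi>\<bar> - 2 * (pi * \<bar>\<xi>\<bar>)))"
    by (intro has_bochner_integral_mult_right has_bochner_integral_diff
        has_bochner_integral_add has_bochner_integral_one_minus_cos)
  moreover have "(1 / (2 * pi)) * ((1 - cos ((s + \<xi>) * x)) / x\<^sup>2 + (1 - cos ((s - \<xi>) * x)) / x\<^sup>2
             - 2 * ((1 - cos (\<xi> * x)) / x\<^sup>2)) = cos (\<xi> * x) * ((1 - cos (s * x)) / (pi * x\<^sup>2))" for x
    by (cases "x = 0") (simp_all add: distrib_right left_diff_distrib cos_add cos_diff field_simps)
  moreover have "(1 / (2 * pi)) * (pi * \<bar>s + \<xi>\<bar> + pi * \<bar>s - \<xi>\<bar> - 2 * (pi * \<bar>\<xi>\<bar>)) = max 0 (s - \<bar>\<xi>\<bar>)"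
    using assms by (auto simp: field_simps abs_if max_def)
  ultimately show ?thesis by simp
qed

section \<open>Polya's criterion with a density\<close>

text \<open>
  Functions \<open>g\<close> on \<open>(0, \<infinity>)\<close> that are convex and decrease from 1 to 0, with first and second derivatives
  \<open>g1\<close> and \<open>g2\<close>. The values of \<open>g\<close> at 0 and at negative arguments are irrelevant.
\<close>

locale convex_profile =
  fixes g g1 g2 :: "real \<Rightarrow> real"
  assumes deriv1: "\<And>r. 0 < r \<Longrightarrow> (g has_real_derivative g1 r) (at r)"
    and deriv2: "\<And>r. 0 < r \<Longrightarrow> (g1 has_real_derivative g2 r) (at r)"
    and cont2: "\<And>r. 0 < r \<Longrightarrow> isCont g2 r"
    and nonpos1: "\<And>r. 0 < r \<Longrightarrow> g1 r \<le> 0"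
    and nonneg2: "\<And>r. 0 < r \<Longrightarrow> 0 \<le> g2 r"
    and at_0: "(g \<longlongrightarrow> 1) (at_right 0)"
    and at_infinity: "(g \<longlongrightarrow> 0) at_top"
begin

lemma derivative_mono: "0 < r \<Longrightarrow> r \<le> s \<Longrightarrow> g1 r \<le> g1 s"
  by (rule DERIV_nonneg_imp_nondecreasing[of r s g1]) (auto intro!: exI[of _ "g2 _"] deriv2 nonneg2)

lemma secant_bound:
  assumes "0 \<le> a" "a < s"
  shows "2 * (g s - g ((s + a) / 2)) \<le> (s - a) * g1 s"
proof -
  have "\<exists>z. (s + a) / 2 < z \<and> z < s \<and> g s - g ((s + a) / 2) = (s - (s + a) / 2) * g1 z"
    using assms by (intro MVT2) (auto intro: deriv1)
  then obtain z where z: "(s + a) / 2 < z" "z < s"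
    and eq: "g s - g ((s + a) / 2) = (s - (s + a) / 2) * g1 z" by blast
  have "g1 z \<le> g1 s"
    using assms z by (intro derivative_mono) auto
  then have "(s - a) * g1 z \<le> (s - a) * g1 s"
    using assms by (intro mult_left_mono) auto
  then show ?thesis
    unfolding eq by (simp add: field_simps)
qed

text \<open>
  Convexity makes \<open>(s - a) * g1 s\<close> small wherever \<open>g\<close> varies little between \<open>(s + a) / 2\<close> and \<open>s\<close>. This
  disposes of the boundary terms of the following integral both at \<open>a\<close> and at infinity.
\<close>

lemma tendsto_scaled_derivative:
  assumes a: "0 \<le> a" and F: "eventually (\<lambda>s. a < s) F"
    and lim: "((\<lambda>s. g s) \<longlongrightarrow> G) F" and lim_half: "((\<lambda>s. g ((s + a) / 2)) \<longlongrightarrow> G) F"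
  shows "((\<lambda>s. (s - a) * g1 s) \<longlongrightarrow> 0) F"
proof (rule tendsto_sandwich)
  show "eventually (\<lambda>s. 2 * (g s - g ((s + a) / 2)) \<le> (s - a) * g1 s) F"
    using F by eventually_elim (use a secant_bound in blast)
  show "eventually (\<lambda>s. (s - a) * g1 s \<le> 0) F"
    using F by eventually_elim (use a in \<open>auto intro!: mult_nonneg_nonpos nonpos1\<close>)
  show "((\<lambda>s. 2 * (g s - g ((s + a) / 2))) \<longlongrightarrow> 0) F"
    using tendsto_mult[OF tendsto_const tendsto_diff[OF lim lim_half], of 2] by simp
qed simp

text \<open>
  The value \<open>G\<close> is \<open>g a\<close> for \<open>a > 0\<close> and 1 for \<open>a = 0\<close>. The integrand has the antiderivative
  \<open>(s - a) * g1 s - g s\<close>.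
\<close>

lemma has_bochner_integral_tent_mixture:
  assumes a: "0 \<le> a" and G: "(g \<longlongrightarrow> G) (at_right a)"
  shows "has_bochner_integral lborel (\<lambda>s. indicator {a<..} s * ((s - a) * g2 s)) G"
proof -
  let ?F = "\<lambda>s. (s - a) * g1 s - g s"
  have right: "filterlim (\<lambda>s. (s + a) / 2) (at_right a) (at_right a)"
    unfolding filterlim_at
    by (auto intro!: tendsto_eq_intros simp: eventually_at_filter)
  have top: "filterlim (\<lambda>s. (s + a) / 2) at_top at_top"
    by real_asymp
  have "has_bochner_integral lborel (\<lambda>s. indicator {a<..} s * ((s - a) * g2 s)) ((0 - 0) - (0 - G))"
  proof (rule has_bochner_integral_FTC_halfline)
    fix s assume s: "a < s"
    with a have "0 < s" by simp
    show "(?F has_real_derivative (s - a) * g2 s) (at s)"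
      using deriv1[OF \<open>0 < s\<close>] deriv2[OF \<open>0 < s\<close>] by (auto intro!: derivative_eq_intros)
    show "isCont (\<lambda>s. (s - a) * g2 s) s"
      using cont2[OF \<open>0 < s\<close>] by (intro continuous_intros)
    show "0 \<le> (s - a) * g2 s"
      using s nonneg2[OF \<open>0 < s\<close>] by simp
  next
    show "(?F \<longlongrightarrow> 0 - G) (at_right a)"
      by (intro tendsto_diff tendsto_scaled_derivative[where G = G] a G filterlim_compose[OF G right]
          eventually_at_right_less)
    show "(?F \<longlongrightarrow> 0 - 0) at_top"
      by (intro tendsto_diff tendsto_scaled_derivative[where G = 0] a at_infinity
          filterlim_compose[OF at_infinity top] eventually_gt_at_top)
  qed
  then show ?thesis by simp
qed

lemma isCont_profile: "0 < r \<Longrightarrow> isCont g r"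
  using deriv1 DERIV_isCont by blast

text \<open>
  The Fejer kernel whose Fourier transform is supported on \<open>[-s, s]\<close>, weighted by \<open>g2 s\<close>. At \<open>x = 0\<close> it takes the value 0, by division by zero,
  which affects only a null set.
\<close>

definition kernel :: "real \<Rightarrow> real \<Rightarrow> real" where
  "kernel s x = indicator {0<..} s * g2 s * ((1 - cos (s * x)) / (pi * x\<^sup>2))"

text \<open>
  The density whose characteristic function is \<open>g \<bar>\<xi>\<bar>\<close>. By Fubini's theorem the integral
  converges for almost every \<open>x\<close>.
\<close>

definition polya_density :: "real \<Rightarrow> real" where
  "polya_density x = (LINT s|lborel. kernel s x)"

lemma kernel_nonneg: "0 \<le> kernel s x"
  by (auto simp: kernel_def indicator_def nonneg2)

lemma measurable_kernel [measurable]: "case_prod kernel \<in> borel_measurable (lborel \<Otimes>\<^sub>M lborel)"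
proof -
  have "(\<lambda>s. indicator {0<..} s *\<^sub>R g2 s) \<in> borel_measurable borel"
    by (intro borel_measurable_continuous_on_indicator continuous_at_imp_continuous_on)
       (auto intro: cont2)
  then have [measurable]: "(\<lambda>s. indicator {0<..} s * g2 s) \<in> borel_measurable borel"
    by simp
  show ?thesis
    unfolding kernel_def by measurable
qed

lemma has_bochner_integral_cos_kernel:
  "has_bochner_integral lborel (\<lambda>x. cos (\<xi> * x) * kernel s x)
     (indicator {0<..} s * g2 s * max 0 (s - \<bar>\<xi>\<bar>))"
proof (cases "0 < s")
  case True
  from has_bochner_integral_mult_right[OF has_bochner_integral_fejer[of s \<xi>], of "g2 s"] True
  show ?thesis by (simp add: kernel_def mult_ac)
next
  case False
  then show ?thesis
    by (simp add: kernel_def has_bochner_integral_zero)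
qed

lemma integrable_kernel: "integrable (lborel \<Otimes>\<^sub>M lborel) (case_prod kernel)"
proof -
  have inner: "has_bochner_integral lborel (kernel s) (indicator {0<..} s * (s * g2 s))" for s
    using has_bochner_integral_cos_kernel[of 0 s]
    by (cases "0 < s") (auto simp: mult_ac max_def)
  have norm_inner: "(LINT x|lborel. \<bar>kernel s x\<bar>) = indicator {0<..} s * (s * g2 s)" for s
    using inner[of s] by (simp add: kernel_nonneg has_bochner_integral_iff)
  show ?thesis
  proof (rule lborel_pair.Fubini_integrable)
    show "integrable lborel (\<lambda>s. LINT x|lborel. norm (case_prod kernel (s, x)))"
      using has_bochner_integral_tent_mixture[OF order_refl at_0]
      by (simp add: norm_inner has_bochner_integral_iff)
    show "AE s in lborel. integrable lborel (\<lambda>x. case_prod kernel (s, x))"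
      using inner by (auto simp: has_bochner_integral_iff)
  qed measurable
qed

lemma polya_density_nonneg: "0 \<le> polya_density x"
  by (simp add: polya_density_def kernel_nonneg)

lemma measurable_polya_density [measurable]: "polya_density \<in> borel_measurable borel"
proof -
  have [measurable]: "(\<lambda>(x, s). kernel s x) \<in> borel_measurable (lborel \<Otimes>\<^sub>M lborel)"
    using measurable_compose[OF measurable_pair_swap' measurable_kernel] by (simp add: case_prod_beta')
  have "(\<lambda>x. LINT s|lborel. kernel s x) \<in> borel_measurable lborel"
    by measurable
  then show ?thesis
    by (simp add: polya_density_def[abs_def])
qed

lemma polya_density_even: "polya_density (- x) = polya_density x"
  by (simp add: polya_density_def kernel_def)

lemma has_bochner_integral_cos_polya_density:
  assumes G: "(g \<longlongrightarrow> G) (at_right \<bar>\<xi>\<bar>)"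
  shows "has_bochner_integral lborel (\<lambda>x. cos (\<xi> * x) * polya_density x) G"
proof -
  have int: "integrable (lborel \<Otimes>\<^sub>M lborel) (\<lambda>(s, x). cos (\<xi> * x) * kernel s x)"
    by (rule Bochner_Integration.integrable_bound[OF integrable_kernel])
       (auto simp: abs_mult kernel_nonneg split_beta intro!: mult_left_le_one_le)
  have tent: "(LINT x|lborel. cos (\<xi> * x) * kernel s x)
      = indicator {\<bar>\<xi>\<bar><..} s * ((s - \<bar>\<xi>\<bar>) * g2 s)" for s
    using has_bochner_integral_cos_kernel[of \<xi> s]
    by (auto simp: has_bochner_integral_iff indicator_def max_def)
  have "(LINT x|lborel. LINT s|lborel. cos (\<xi> * x) * kernel s x)
      = (LINT s|lborel. LINT x|lborel. cos (\<xi> * x) * kernel s x)"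
    by (rule lborel_pair.Fubini_integral[OF int])
  also have "\<dots> = G"
    using has_bochner_integral_tent_mixture[OF _ G]
    by (simp add: tent has_bochner_integral_iff)
  finally have "(LINT x|lborel. cos (\<xi> * x) * polya_density x) = G"
    by (simp add: polya_density_def)
  moreover have "integrable lborel (\<lambda>x. cos (\<xi> * x) * polya_density x)"
    using lborel_pair.integrable_snd[OF int] by (simp add: polya_density_def)
  ultimately show ?thesis
    by (simp add: has_bochner_integral_iff)
qed

lemma real_distribution_polya: "real_distribution (density lborel polya_density)"
proof -
  have "has_bochner_integral lborel polya_density 1"
    using has_bochner_integral_cos_polya_density[of 1 0] at_0 by simp
  then have "(\<integral>\<^sup>+ x. ennreal (polya_density x) \<partial>lborel) = 1"
    by (subst nn_integral_eq_integral)
       (auto simp: has_bochner_integral_iff polya_density_nonneg)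
  then have "prob_space (density lborel polya_density)"
    by (intro prob_spaceI) (simp add: emeasure_density)
  then show ?thesis
    by (simp add: real_distribution_def real_distribution_axioms_def)
qed

text \<open>
  The sine part of the Fourier transform vanishes since the density is even.
\<close>

lemma char_polya:
  assumes "\<xi> \<noteq> 0"
  shows "char (density lborel polya_density) \<xi> = complex_of_real (g \<bar>\<xi>\<bar>)"
proof -
  have "(g \<longlongrightarrow> g \<bar>\<xi>\<bar>) (at_right \<bar>\<xi>\<bar>)"
    using isCont_profile[of "\<bar>\<xi>\<bar>"] assms
    by (auto simp: isCont_def intro: tendsto_within_subset)
  note cos_int = has_bochner_integral_cos_polya_density[OF this]
  have "integrable lborel polya_density"
    using has_bochner_integral_cos_polya_density[of 1 0] at_0 by (simp add: has_bochner_integral_iff)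
  then have sin_int: "integrable lborel (\<lambda>x. sin (\<xi> * x) * polya_density x)"
    by (rule Bochner_Integration.integrable_bound)
       (auto simp: abs_mult polya_density_nonneg intro!: mult_left_le_one_le)
  have "(LINT x|lborel. sin (\<xi> * x) * polya_density x)
      = (LINT x|lborel. sin (\<xi> * (- x)) * polya_density (- x))"
    using lborel_integral_real_affine[of "-1" "\<lambda>x. sin (\<xi> * x) * polya_density x" 0] by simp
  then have sin_0: "(LINT x|lborel. sin (\<xi> * x) * polya_density x) = 0"
    by (simp add: polya_density_even)
  have "char (density lborel polya_density) \<xi> = (CLINT x|lborel. polya_density x *\<^sub>R iexp (\<xi> * x))"
    unfolding char_def by (rule integral_density) (auto simp: polya_density_nonneg)
  also have "(\<lambda>x. polya_density x *\<^sub>R iexp (\<xi> * x))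
      = (\<lambda>x. complex_of_real (cos (\<xi> * x) * polya_density x)
           + \<i> * complex_of_real (sin (\<xi> * x) * polya_density x))"
    by (auto simp: fun_eq_iff complex_eq_iff scaleR_conv_of_real Re_exp Im_exp)
  also have "(CLINT x|lborel. complex_of_real (cos (\<xi> * x) * polya_density x)
           + \<i> * complex_of_real (sin (\<xi> * x) * polya_density x))
      = complex_of_real (g \<bar>\<xi>\<bar>) + \<i> * complex_of_real 0"
    using cos_int sin_int sin_0
    by (subst Bochner_Integration.integral_add)
       (auto simp: has_bochner_integral_iff simp del: of_real_mult)
  finally show ?thesis by simp
qed

end

section \<open>Concave functions with two derivatives\<close>

text \<open>
  Positive, nondecreasing, concave and twice continuously differentiable functions on \<open>(0, \<infinity>)\<close>. Nothing is
  said about the values outside this half-line. Positivity makes the class closed under composition.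
\<close>

definition smooth_concave :: "(real \<Rightarrow> real) \<Rightarrow> bool" where
  "smooth_concave f \<longleftrightarrow> (\<exists>f1 f2. \<forall>x>0. 0 < f x \<and> (f has_real_derivative f1 x) (at x) \<and>
     (f1 has_real_derivative f2 x) (at x) \<and> isCont f2 x \<and> 0 \<le> f1 x \<and> f2 x \<le> 0)"

lemma smooth_concave_compose:
  assumes "smooth_concave h" "smooth_concave f"
  shows "smooth_concave (\<lambda>x. h (f x))"
proof -
  from assms(1) obtain h1 h2 where h: "\<And>y. 0 < y \<Longrightarrow> 0 < h y \<and>
      (h has_real_derivative h1 y) (at y) \<and> (h1 has_real_derivative h2 y) (at y) \<and>
      isCont h2 y \<and> 0 \<le> h1 y \<and> h2 y \<le> 0"
    unfolding smooth_concave_def by blast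
  from assms(2) obtain f1 f2 where f: "\<And>x. 0 < x \<Longrightarrow> 0 < f x \<and>
      (f has_real_derivative f1 x) (at x) \<and> (f1 has_real_derivative f2 x) (at x) \<and>
      isCont f2 x \<and> 0 \<le> f1 x \<and> f2 x \<le> 0"
    unfolding smooth_concave_def by blast
  show ?thesis
    unfolding smooth_concave_def
  proof (intro exI allI impI conjI)
    fix x :: real assume "0 < x"
    note fx = f[OF this]
    then have hx: "0 < h (f x)" "(h has_real_derivative h1 (f x)) (at (f x))"
        "(h1 has_real_derivative h2 (f x)) (at (f x))" "isCont h2 (f x)" "0 \<le> h1 (f x)" "h2 (f x) \<le> 0"
      using h by blast+
    from fx have f': "(f has_real_derivative f1 x) (at x)" "(f1 has_real_derivative f2 x) (at x)"
      and cont: "isCont f x" "isCont f1 x" "isCont f2 x"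
      by (auto intro: DERIV_isCont)
    show "0 < h (f x)" by fact
    show "((\<lambda>x. h (f x)) has_real_derivative h1 (f x) * f1 x) (at x)"
      by (rule DERIV_chain2[OF hx(2) f'(1)])
    show "((\<lambda>x. h1 (f x) * f1 x) has_real_derivative
        h2 (f x) * f1 x * f1 x + f2 x * h1 (f x)) (at x)"
      by (rule DERIV_mult[OF DERIV_chain2[OF hx(3) f'(1)] f'(2)])
    have "isCont (\<lambda>x. h1 (f x)) x" "isCont (\<lambda>x. h2 (f x)) x"
      using cont(1) hx(3,4) by (auto intro: isCont_o2 DERIV_isCont)
    then show "isCont (\<lambda>x. h2 (f x) * f1 x * f1 x + f2 x * h1 (f x)) x"
      using cont by (intro continuous_intros)
    show "0 \<le> h1 (f x) * f1 x"
      using fx hx by simp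
    have "h2 (f x) * (f1 x * f1 x) \<le> 0" "f2 x * h1 (f x) \<le> 0"
      using fx hx by (auto intro: mult_nonpos_nonneg)
    then show "h2 (f x) * f1 x * f1 x + f2 x * h1 (f x) \<le> 0"
      by (simp add: mult.assoc)
  qed
qed

lemma smooth_concave_ident: "smooth_concave (\<lambda>x. x)"
  unfolding smooth_concave_def
  by (intro exI[of _ "\<lambda>_. 1"] exI[of _ "\<lambda>_. 0"]) (auto intro: DERIV_ident)

lemma smooth_concave_ln: "smooth_concave (\<lambda>x. ln (1 + x))"
  unfolding smooth_concave_def
proof (intro exI allI impI conjI)
  fix x :: real assume x: "0 < x"
  show "((\<lambda>x. ln (1 + x)) has_real_derivative 1 / (1 + x)) (at x)"
    using x by (auto intro!: derivative_eq_intros)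
  show "((\<lambda>x. 1 / (1 + x)) has_real_derivative - 1 / (1 + x)\<^sup>2) (at x)"
    using x by (auto intro!: derivative_eq_intros simp: power2_eq_square)
  show "isCont (\<lambda>x. - 1 / (1 + x)\<^sup>2) x"
    using x by (auto intro!: continuous_intros)
qed auto

lemma smooth_concave_powr:
  assumes "0 < \<epsilon>" "\<epsilon> \<le> 1"
  shows "smooth_concave (\<lambda>x. x powr \<epsilon>)"
  unfolding smooth_concave_def
proof (intro exI allI impI conjI)
  fix x :: real assume x: "0 < x"
  show "((\<lambda>x. x powr \<epsilon>) has_real_derivative \<epsilon> * x powr (\<epsilon> - 1)) (at x)"
    using x by (auto intro!: derivative_eq_intros)
  show "((\<lambda>x. \<epsilon> * x powr (\<epsilon> - 1)) has_real_derivative \<epsilon> * (\<epsilon> - 1) * x powr (\<epsilon> - 2)) (at x)"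
    using x by (auto intro!: derivative_eq_intros)
  show "isCont (\<lambda>x. \<epsilon> * (\<epsilon> - 1) * x powr (\<epsilon> - 2)) x"
    using x by (auto intro!: continuous_intros)
  show "\<epsilon> * (\<epsilon> - 1) * x powr (\<epsilon> - 2) \<le> 0"
    using assms by (intro mult_nonpos_nonneg mult_nonneg_nonpos) auto
qed (use assms in auto)

lemma convex_profile_exp:
  assumes f: "smooth_concave f" and t: "0 < t"
    and zero: "(f \<longlongrightarrow> 0) (at_right 0)" and top: "filterlim f at_top at_top"
  shows "\<exists>g1 g2. convex_profile (\<lambda>r. exp (- (t * f r))) g1 g2"
proof -
  from f obtain f1 f2 where f: "\<And>x. 0 < x \<Longrightarrow> (f has_real_derivative f1 x) (at x)"
      "\<And>x. 0 < x \<Longrightarrow> (f1 has_real_derivative f2 x) (at x)"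
      "\<And>x. 0 < x \<Longrightarrow> isCont f2 x" "\<And>x. 0 < x \<Longrightarrow> 0 \<le> f1 x" "\<And>x. 0 < x \<Longrightarrow> f2 x \<le> 0"
    unfolding smooth_concave_def by metis
  let ?g = "\<lambda>r. exp (- (t * f r))"
  have "convex_profile ?g (\<lambda>r. - (t * f1 r) * ?g r) (\<lambda>r. ((t * f1 r)\<^sup>2 - t * f2 r) * ?g r)"
  proof
    fix r :: real assume r: "0 < r"
    have cont: "isCont f r" "isCont f1 r"
      using f(1,2)[OF r] by (auto intro: DERIV_isCont)
    show "(?g has_real_derivative - (t * f1 r) * ?g r) (at r)"
      using f(1)[OF r] by (auto intro!: derivative_eq_intros)
    show "((\<lambda>r. - (t * f1 r) * ?g r) has_real_derivative ((t * f1 r)\<^sup>2 - t * f2 r) * ?g r) (at r)"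
      using f(1,2)[OF r] by (auto intro!: derivative_eq_intros simp: algebra_simps power2_eq_square)
    show "isCont (\<lambda>r. ((t * f1 r)\<^sup>2 - t * f2 r) * ?g r) r"
      using cont f(3)[OF r] by (intro continuous_intros)
    show "- (t * f1 r) * ?g r \<le> 0"
      using f(4)[OF r] t by simp
    have "t * f2 r \<le> 0"
      using f(5)[OF r] t by (simp add: mult_nonneg_nonpos)
    then show "0 \<le> ((t * f1 r)\<^sup>2 - t * f2 r) * ?g r"
      using zero_le_power2[of "t * f1 r"] by (intro mult_nonneg_nonneg) (linarith, simp)
  next
    have "(?g \<longlongrightarrow> exp (- (t * 0))) (at_right 0)"
      by (intro tendsto_intros zero)
    then show "(?g \<longlongrightarrow> 1) (at_right 0)" by simp
  next
    have "filterlim (\<lambda>r. - (t * f r)) at_bot at_top"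
      unfolding filterlim_uminus_at_bot
      using filterlim_tendsto_pos_mult_at_top[OF tendsto_const t top] by simp
    then show "(?g \<longlongrightarrow> 0) at_top"
      by (rule filterlim_compose[OF exp_at_bot])
  qed
  then show ?thesis by blast
qed

lemma iter_log_eq: "iter_log n \<xi> = ((\<lambda>y. ln (1 + y)) ^^ n) \<bar>\<xi>\<bar>"
  by (induction n) simp_all

lemma smooth_concave_iterated_ln: "smooth_concave ((\<lambda>y. ln (1 + y)) ^^ n)"
proof (induction n)
  case 0
  then show ?case by (simp add: smooth_concave_ident id_def)
next
  case (Suc n)
  from smooth_concave_compose[OF smooth_concave_ln this] show ?case by (simp add: comp_def)
qed

lemma iterated_ln_tendsto_0: "(((\<lambda>y::real. ln (1 + y)) ^^ n) \<longlongrightarrow> 0) (at_right 0)"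
proof (induction n)
  case (Suc n)
  have "((\<lambda>x. ln (1 + ((\<lambda>y::real. ln (1 + y)) ^^ n) x)) \<longlongrightarrow> ln (1 + 0)) (at_right 0)"
    by (intro tendsto_intros Suc) simp
  then show ?case by (simp add: comp_def)
qed (simp add: id_def)

lemma iterated_ln_at_top: "filterlim ((\<lambda>y::real. ln (1 + y)) ^^ n) at_top at_top"
proof (induction n)
  case (Suc n)
  have "filterlim (\<lambda>y::real. ln (1 + y)) at_top at_top"
    by real_asymp
  from filterlim_compose[OF this Suc] show ?case by (simp add: comp_def)
qed (simp add: id_def filterlim_ident)

text \<open>
  The hypothesis \<open>f 0 = 0\<close> only matches the value at \<open>\<xi> = 0\<close> with the right limit of \<open>f\<close>.
\<close>

lemma ex_polya_semigroup:
  assumes f: "smooth_concave f" "(f \<longlongrightarrow> 0) (at_right 0)" "filterlim f at_top at_top" "f 0 = 0"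
  shows "\<exists>p. \<forall>t>0. (\<forall>x. 0 \<le> p t x) \<and> p t \<in> borel_measurable borel \<and>
    real_distribution (density lborel (\<lambda>x. ennreal (p t x))) \<and>
    (\<forall>\<xi>. char (density lborel (\<lambda>x. ennreal (p t x))) \<xi> = complex_of_real (exp (- (t * f \<bar>\<xi>\<bar>))))"
    (is "\<exists>p. \<forall>t>0. ?P t (p t)")
proof -
  have "\<exists>q. ?P t q" if t: "0 < t" for t
  proof -
    obtain g1 g2 where "convex_profile (\<lambda>r. exp (- (t * f r))) g1 g2"
      using convex_profile_exp[OF f(1) t f(2,3)] by blast
    then interpret convex_profile "\<lambda>r. exp (- (t * f r))" g1 g2 .
    have "char (density lborel polya_density) \<xi> = complex_of_real (exp (- (t * f \<bar>\<xi>\<bar>)))" for \<xi>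
      using real_distribution.char_zero[OF real_distribution_polya] char_polya[of \<xi>] f(4)
      by (cases "\<xi> = 0") simp_all
    then show ?thesis
      using real_distribution_polya polya_density_nonneg measurable_polya_density by blast
  qed
  then show ?thesis by metis
qed

section \<open>Independence and product measures\<close>

text \<open>
  Independence transfers between a probability space and its image under a measurable map.
\<close>

lemma (in prob_space) indep_vars_distr:
  assumes [measurable]: "T \<in> measurable M N" "\<And>i. i \<in> I \<Longrightarrow> X i \<in> measurable N (M' i)"
  shows "prob_space.indep_vars (distr M N T) M' X I \<longleftrightarrow> indep_vars M' (\<lambda>i x. X i (T x)) I"
proof -
  interpret N: prob_space "distr M N T"
    by (rule prob_space_distr) simp
  show ?thesis
  proof (cases "I = {}")
    case True
    then show ?thesis
      by (simp add: N.indep_vars_def indep_vars_def N.indep_sets_def indep_sets_def)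
  next
    case False
    then show ?thesis
      by (subst N.indep_vars_iff_distr_eq_PiM', simp, simp,
          subst indep_vars_iff_distr_eq_PiM', simp, simp)
         (simp add: distr_distr comp_def cong: PiM_cong)
  qed
qed

lemma indep_vars_PiM_coordinates:
  assumes "finite H" and \<nu>: "\<And>i. i \<in> H \<Longrightarrow> prob_space (\<nu> i)" "\<And>i. i \<in> H \<Longrightarrow> sets (\<nu> i) = sets (M' i)"
  shows "prob_space.indep_vars (PiM H \<nu>) M' (\<lambda>i x. x i) H"
proof -
  interpret prob_space "PiM H \<nu>"
    by (rule prob_space_PiM) (rule \<nu>)
  have sets: "sets (PiM H \<nu>) = sets (PiM H M')"
    using \<nu>(2) by (intro sets_PiM_cong) auto
  show ?thesis
  proof (cases "H = {}")
    case True
    then show ?thesis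
      unfolding indep_vars_def indep_sets_def by auto
  next
    case False
    have coordinate: "(\<lambda>x. x i) \<in> measurable (PiM H \<nu>) (M' i)" if "i \<in> H" for i
      using measurable_component_singleton[OF that, of \<nu>] measurable_cong_sets[OF refl \<nu>(2)[OF that]]
      by blast
    have comp: "distr (PiM H \<nu>) (M' i) (\<lambda>x. x i) = \<nu> i" if "i \<in> H" for i
      using distr_PiM_component[of H \<nu> i] \<nu> that by (simp cong: distr_cong)
    have "distr (PiM H \<nu>) (PiM H M') (\<lambda>x. \<lambda>i\<in>H. x i) = distr (PiM H \<nu>) (PiM H \<nu>) (\<lambda>x. x)"
      by (rule distr_cong) (auto simp: sets space_PiM extensional_restrict PiE_def)
    also have "\<dots> = PiM H \<nu>"
      by (rule distr_id)
    also have "\<dots> = PiM H (\<lambda>i. distr (PiM H \<nu>) (M' i) (\<lambda>x. x i))"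
      by (rule PiM_cong) (auto simp: comp)
    finally show ?thesis
      using False coordinate by (subst indep_vars_iff_distr_eq_PiM') auto
  qed
qed

section \<open>Consecutive times\<close>

text \<open>
  The largest element of \<open>H\<close> before \<open>t\<close>, or 0 if there is none. The set \<open>H\<close> is meant to consist of nonnegative
  times.
\<close>

definition pred_time :: "real set \<Rightarrow> real \<Rightarrow> real" where
  "pred_time H t = Max (insert 0 {s \<in> H. s < t})"

lemma pred_time_ge: "finite H \<Longrightarrow> s \<in> H \<Longrightarrow> s < t \<Longrightarrow> s \<le> pred_time H t"
  unfolding pred_time_def by (rule Max_ge) auto

lemma pred_time_nonneg: "finite H \<Longrightarrow> 0 \<le> pred_time H t"
  unfolding pred_time_def by (rule Max_ge) auto

lemma pred_time_cases: "finite H \<Longrightarrow> pred_time H t = 0 \<or> pred_time H t \<in> H \<and> pred_time H t < t"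
  using Max_in[of "insert 0 {s \<in> H. s < t}"] unfolding pred_time_def by auto

lemma pred_time_le: "finite H \<Longrightarrow> 0 \<le> t \<Longrightarrow> pred_time H t \<le> t"
  using pred_time_cases[of H t] by auto

lemma disjoint_pred_intervals:
  "finite H \<Longrightarrow> disjoint_family_on (\<lambda>u. K \<inter> {pred_time H u<..u}) H"
  unfolding disjoint_family_on_def
proof (intro ballI impI)
  fix u v assume "finite H" "u \<in> H" "v \<in> H" "u \<noteq> v"
  then show "K \<inter> {pred_time H u<..u} \<inter> (K \<inter> {pred_time H v<..v}) = {}"
    using pred_time_ge[of H u v] pred_time_ge[of H v u] by (cases u v rule: linorder_cases) auto
qed

text \<open>
  The intervals between consecutive times of \<open>H\<close> partition \<open>(0, t]\<close>. The set \<open>K\<close> will be a finer set of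
  times, or everything.
\<close>

lemma UN_pred_intervals:
  assumes H: "finite H" and t: "t \<in> insert 0 H"
  shows "(\<Union>u\<in>H \<inter> {0<..t}. K \<inter> {pred_time H u<..u}) = K \<inter> {0<..t}"
proof (intro equalityI subsetI)
  fix s assume "s \<in> (\<Union>u\<in>H \<inter> {0<..t}. K \<inter> {pred_time H u<..u})"
  then show "s \<in> K \<inter> {0<..t}"
    using pred_time_nonneg[OF H] by (auto intro: le_less_trans)
next
  fix s assume s: "s \<in> K \<inter> {0<..t}"
  let ?A = "{u \<in> H. s \<le> u}"
  have A: "finite ?A" "t \<in> ?A"
    using s t H by auto
  define u where "u = Min ?A"
  have "u \<in> ?A"
    unfolding u_def using A by (intro Min_in) auto
  moreover have "u \<le> t"
    unfolding u_def using A by (intro Min_le)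
  ultimately have u: "u \<in> ?A" "u \<le> t"
    by blast+
  have "pred_time H u < s"
  proof (rule ccontr)
    assume "\<not> pred_time H u < s"
    then have "pred_time H u \<in> ?A" "pred_time H u < u"
      using pred_time_cases[OF H, of u] s by auto
    then show False
      using Min_le[OF A(1)] by (auto simp: u_def not_le[symmetric])
  qed
  with s u show "s \<in> (\<Union>u\<in>H \<inter> {0<..t}. K \<inter> {pred_time H u<..u})"
    by auto
qed

text \<open>
  The sum is the total length of the pieces of this partition.
\<close>

lemma sum_pred_differences_0:
  assumes H: "finite H" and t: "t \<in> insert 0 H" "0 \<le> t"
  shows "(\<Sum>u\<in>H \<inter> {0<..t}. u - pred_time H u) = t"
proof -
  have "t = measure lborel {0<..t}"
    using t by simp
  also have "{0<..t} = (\<Union>u\<in>H \<inter> {0<..t}. {pred_time H u<..u})"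
    using UN_pred_intervals[OF H t(1), of UNIV] by simp
  also have "measure lborel \<dots> = (\<Sum>u\<in>H \<inter> {0<..t}. measure lborel {pred_time H u<..u})"
    using H disjoint_family_on_mono[OF _ disjoint_pred_intervals[OF H, of UNIV], of "H \<inter> {0<..t}"]
    by (intro measure_finite_Union) (auto simp: pred_time_le)
  also have "\<dots> = (\<Sum>u\<in>H \<inter> {0<..t}. u - pred_time H u)"
    using H by (intro sum.cong) (auto intro!: measure_lborel_Ioc pred_time_le)
  finally show ?thesis by simp
qed

lemma sum_Ioc_split:
  fixes f :: "real \<Rightarrow> real"
  assumes "finite H" "0 \<le> a" "a \<le> b"
  shows "sum f (H \<inter> {a<..b}) = sum f (H \<inter> {0<..b}) - sum f (H \<inter> {0<..a})"
proof -
  have "H \<inter> {0<..b} = (H \<inter> {0<..a}) \<union> (H \<inter> {a<..b})"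
    using assms by auto
  moreover have "sum f ((H \<inter> {0<..a}) \<union> (H \<inter> {a<..b})) = sum f (H \<inter> {0<..a}) + sum f (H \<inter> {a<..b})"
    using assms by (intro sum.union_disjoint) auto
  ultimately show ?thesis by simp
qed

lemma sum_pred_differences:
  assumes "finite H" "a \<in> insert 0 H" "b \<in> insert 0 H" "0 \<le> a" "a \<le> b"
  shows "(\<Sum>u\<in>H \<inter> {a<..b}. u - pred_time H u) = b - a"
  using assms by (subst sum_Ioc_split) (auto simp: sum_pred_differences_0)

section \<open>From a convolution semigroup to a process\<close>

text \<open>
  A family of laws with characteristic functions \<open>exp (- t * \<psi> \<xi>)\<close>. The semigroup law
  under convolution is implied.
\<close>

locale convolution_semigroup =
  fixes \<mu> :: "real \<Rightarrow> real measure" and \<psi> :: "real \<Rightarrow> complex"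
  assumes distribution: "\<And>t. 0 \<le> t \<Longrightarrow> real_distribution (\<mu> t)"
    and char_eq: "\<And>t \<xi>. 0 \<le> t \<Longrightarrow> char (\<mu> t) \<xi> = exp (- (complex_of_real t * \<psi> \<xi>))"
begin

text \<open>
  The joint law of the increments over \<open>H\<close>, each increment being indexed by the time at which it ends.
\<close>

definition increments :: "real set \<Rightarrow> (real \<Rightarrow> real) measure" where
  "increments H = (\<Pi>\<^sub>M t\<in>H. \<mu> (t - pred_time H t))"

text \<open>
  The positions of the process as functions of the increments. An increment ending at time 0 is left out,
  so that the process starts at 0 exactly.
\<close>

definition partial_sums :: "real set \<Rightarrow> (real \<Rightarrow> real) \<Rightarrow> real \<Rightarrow> real" where
  "partial_sums H z = (\<lambda>t\<in>H. \<Sum>s\<in>H \<inter> {0<..t}. z s)"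

text \<open>
  The joint law of the process at the times in \<open>H\<close>.
\<close>

definition fdd :: "real set \<Rightarrow> (real \<Rightarrow> real) measure" where
  "fdd H = distr (increments H) (\<Pi>\<^sub>M t\<in>H. borel) (partial_sums H)"

context
  fixes H :: "real set"
  assumes H: "finite H" "H \<subseteq> {0..}"
begin

lemma distribution_increment: "t \<in> H \<Longrightarrow> real_distribution (\<mu> (t - pred_time H t))"
  using H by (intro distribution) (auto intro: pred_time_le)

lemma prob_space_increments: "prob_space (increments H)"
  unfolding increments_def using distribution_increment
  by (intro prob_space_PiM) (auto simp: real_distribution_def)

lemma sets_increments [measurable_cong]: "sets (increments H) = sets (\<Pi>\<^sub>M t\<in>H. borel)"
  unfolding increments_def
  using real_distribution.events_eq_borel[OF distribution_increment] by (intro sets_PiM_cong) auto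

lemma measurable_partial_sums: "partial_sums H \<in> measurable (increments H) (\<Pi>\<^sub>M t\<in>H. borel)"
  unfolding partial_sums_def by measurable

lemma indep_vars_increments: "prob_space.indep_vars (increments H) (\<lambda>_. borel) (\<lambda>s z. z s) H"
  unfolding increments_def
  by (rule indep_vars_PiM_coordinates)
     (auto simp: H dest!: distribution_increment simp: real_distribution_def real_distribution_axioms_def)

lemma indep_vars_block_sums:
  assumes B: "\<And>j. j \<in> L \<Longrightarrow> B j \<subseteq> H" "disjoint_family_on B L"
  shows "prob_space.indep_vars (increments H) (\<lambda>_. borel) (\<lambda>j z. \<Sum>s\<in>B j. z s) L"
proof -
  interpret prob_space "increments H" by (rule prob_space_increments)
  have "indep_vars (\<lambda>j. PiM (B j) (\<lambda>_. borel)) (\<lambda>j z. restrict (\<lambda>s. z s) (B j)) L"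
    by (rule indep_vars_restrict[OF indep_vars_increments B])
  from indep_vars_compose2[OF this, of "\<lambda>j z. \<Sum>s\<in>B j. z s" "\<lambda>_. borel"]
  show ?thesis by simp
qed

lemma distr_interval_sum:
  assumes ab: "a \<in> insert 0 H" "b \<in> insert 0 H" "a \<le> b"
  shows "distr (increments H) borel (\<lambda>z. \<Sum>s\<in>H \<inter> {a<..b}. z s) = \<mu> (b - a)"
proof (rule Levy_uniqueness)
  interpret prob_space "increments H" by (rule prob_space_increments)
  from ab H have a: "0 \<le> a" by auto
  have [measurable]: "(\<lambda>z. \<Sum>s\<in>H \<inter> {a<..b}. z s) \<in> borel_measurable (increments H)"
    by measurable
  show "real_distribution (distr (increments H) borel (\<lambda>z. \<Sum>s\<in>H \<inter> {a<..b}. z s))"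
    by (rule real_distribution_distr) simp
  show "real_distribution (\<mu> (b - a))"
    using ab by (intro distribution) simp
  show "char (distr (increments H) borel (\<lambda>z. \<Sum>s\<in>H \<inter> {a<..b}. z s)) = char (\<mu> (b - a))"
  proof
    fix \<xi>
    have coordinate: "distr (increments H) borel (\<lambda>z. z s) = \<mu> (s - pred_time H s)" if "s \<in> H" for s
    proof -
      have "distr (increments H) (\<mu> (s - pred_time H s)) (\<lambda>z. z s) = \<mu> (s - pred_time H s)"
        unfolding increments_def using that distribution_increment
        by (intro distr_PiM_component[of H "\<lambda>t. \<mu> (t - pred_time H t)"]) (auto simp: real_distribution_def)
      then show ?thesis
        using real_distribution.events_eq_borel[OF distribution_increment[OF that]]
        by (simp cong: distr_cong)
    qed
    have "char (distr (increments H) borel (\<lambda>z. \<Sum>s\<in>H \<inter> {a<..b}. z s)) \<xi>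
        = (\<Prod>s\<in>H \<inter> {a<..b}. char (distr (increments H) borel (\<lambda>z. z s)) \<xi>)"
      by (rule char_distr_sum) (rule indep_vars_subset[OF indep_vars_increments], auto)
    also have "\<dots> = (\<Prod>s\<in>H \<inter> {a<..b}. exp (- (complex_of_real (s - pred_time H s) * \<psi> \<xi>)))"
      using H by (intro prod.cong refl)
        (auto simp: coordinate subset_iff intro!: char_eq pred_time_le simp del: of_real_diff)
    also have "\<dots> = exp (- (complex_of_real (\<Sum>s\<in>H \<inter> {a<..b}. s - pred_time H s) * \<psi> \<xi>))"
      using H by (subst exp_sum[symmetric]) (auto simp: sum_negf sum_distrib_right simp del: of_real_diff)
    also have "\<dots> = char (\<mu> (b - a)) \<xi>"
      using ab a H by (simp add: sum_pred_differences char_eq)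
    finally show "char (distr (increments H) borel (\<lambda>z. \<Sum>s\<in>H \<inter> {a<..b}. z s)) \<xi> = char (\<mu> (b - a)) \<xi>" .
  qed
qed

text \<open>
  The increments over \<open>H\<close>, merged along a coarser set \<open>J\<close> of times, are distributed as the increments over
  \<open>J\<close>.
\<close>

lemma distr_block_sums:
  assumes J: "J \<subseteq> H"
  shows "distr (increments H) (\<Pi>\<^sub>M t\<in>J. borel) (\<lambda>z. \<lambda>u\<in>J. \<Sum>s\<in>H \<inter> {pred_time J u<..u}. z s)
    = increments J"
proof -
  interpret prob_space "increments H" by (rule prob_space_increments)
  have fin: "finite J" using H J finite_subset by blast
  let ?W = "\<lambda>u z. \<Sum>s\<in>H \<inter> {pred_time J u<..u}. z s"
  have [measurable]: "?W u \<in> borel_measurable (increments H)" for u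
    by measurable
  show ?thesis
  proof (cases "J = {}")
    case True
    \<comment> \<open>The characterisation of independence by product measures excludes empty index sets.\<close>
    let ?D = "distr (increments H) (\<Pi>\<^sub>M t\<in>J. borel) (\<lambda>z. \<lambda>u\<in>J. ?W u z)"
    interpret D: prob_space ?D
      by (rule prob_space_distr) simp
    have total: "emeasure ?D {\<lambda>_. undefined} = 1"
      using D.emeasure_space_1 True by (simp add: space_PiM)
    show ?thesis
    proof (rule measure_eqI)
      show "sets ?D = sets (increments J)"
        using True by (simp add: increments_def PiM_empty)
      fix A assume "A \<in> sets ?D"
      then have "A = {} \<or> A = {\<lambda>_. undefined}"
        using True by (simp add: PiM_empty subset_singleton_iff)
      then show "emeasure ?D A = emeasure (increments J) A"
        using total True by (auto simp: increments_def PiM_empty)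
    qed
  next
    case False
    have law: "distr (increments H) borel (?W u) = \<mu> (u - pred_time J u)" if "u \<in> J" for u
      using J H that pred_time_cases[OF fin, of u] pred_time_le[OF fin, of u]
      by (intro distr_interval_sum) (auto simp: subset_iff)
    have "indep_vars (\<lambda>_. borel) ?W J"
      by (rule indep_vars_block_sums) (auto intro!: disjoint_pred_intervals fin)
    then have "distr (increments H) (\<Pi>\<^sub>M t\<in>J. borel) (\<lambda>z. \<lambda>u\<in>J. ?W u z)
        = (\<Pi>\<^sub>M u\<in>J. distr (increments H) borel (?W u))"
      using False by (subst (asm) indep_vars_iff_distr_eq_PiM') auto
    also have "\<dots> = (\<Pi>\<^sub>M u\<in>J. \<mu> (u - pred_time J u))"
      by (intro PiM_cong refl law)
    finally show ?thesis
      by (simp add: increments_def)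
  qed
qed

end

lemma fdd_consistent:
  assumes "J \<subseteq> H" "finite H" "H \<subseteq> {0..}"
  shows "fdd J = distr (fdd H) (\<Pi>\<^sub>M t\<in>J. borel) (\<lambda>f. restrict f J)"
proof -
  have J: "finite J" "J \<subseteq> {0..}"
    using assms finite_subset by blast+
  note [measurable] = measurable_partial_sums[OF assms(2,3)] measurable_partial_sums[OF J]
  note [measurable_cong] = sets_increments[OF assms(2,3)] sets_increments[OF J]
  let ?W = "\<lambda>z. \<lambda>u\<in>J. \<Sum>s\<in>H \<inter> {pred_time J u<..u}. z s"
  have [measurable]: "partial_sums J \<in> measurable (\<Pi>\<^sub>M t\<in>J. borel) (\<Pi>\<^sub>M t\<in>J. borel)"
    unfolding partial_sums_def by measurable
  have [measurable]: "(\<lambda>f. restrict f J) \<in> measurable (\<Pi>\<^sub>M t\<in>H. borel) (\<Pi>\<^sub>M t\<in>J. borel)"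
    by (rule measurable_restrict_subset) fact
  \<comment> \<open>Each partial sum over \<open>H\<close> is regrouped along the intervals between consecutive times of \<open>J\<close>.\<close>
  have regroup: "restrict (partial_sums H z) J = partial_sums J (?W z)" for z
  proof
    fix t
    show "restrict (partial_sums H z) J t = partial_sums J (?W z) t"
    proof (cases "t \<in> J")
      case True
      have "(\<Sum>s\<in>H \<inter> {0<..t}. z s) = sum z (\<Union>u\<in>J \<inter> {0<..t}. H \<inter> {pred_time J u<..u})"
        using True by (subst UN_pred_intervals[OF J(1)]) auto
      also have "\<dots> = (\<Sum>u\<in>J \<inter> {0<..t}. \<Sum>s\<in>H \<inter> {pred_time J u<..u}. z s)"
        using assms J disjoint_pred_intervals[OF J(1), of H]
        by (intro sum.UNION_disjoint) (auto simp: disjoint_family_on_def)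
      finally show ?thesis
        using True assms(1) by (auto simp: partial_sums_def intro!: sum.cong)
    qed (simp add: partial_sums_def)
  qed
  have "distr (fdd H) (\<Pi>\<^sub>M t\<in>J. borel) (\<lambda>f. restrict f J)
      = distr (increments H) (\<Pi>\<^sub>M t\<in>J. borel) (\<lambda>z. partial_sums J (?W z))"
    unfolding fdd_def by (subst distr_distr) (auto simp: comp_def regroup)
  also have "\<dots> = distr (distr (increments H) (\<Pi>\<^sub>M t\<in>J. borel) ?W) (\<Pi>\<^sub>M t\<in>J. borel) (partial_sums J)"
    by (subst distr_distr) (auto simp: comp_def)
  also have "\<dots> = fdd J"
    unfolding fdd_def by (subst distr_block_sums[OF assms(2,3,1)]) simp
  finally show ?thesis by simp
qed

sublocale kolmogorov: polish_projective "{0..}" fdd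
proof (intro polish_projective.intro projective_family.intro)
  fix J :: "real set" assume J: "finite J" "J \<subseteq> {0..}"
  show "prob_space (fdd J)"
    unfolding fdd_def
    by (rule prob_space.prob_space_distr[OF prob_space_increments[OF J] measurable_partial_sums[OF J]])
qed (rule fdd_consistent)

text \<open>
  The law of the process on all paths, that is, on functions on \<open>[0, \<infinity>)\<close> extended by \<open>undefined\<close>; the process
  itself is the family of coordinate maps.
\<close>

abbreviation path_space :: "(real \<Rightarrow> real) measure" where
  "path_space \<equiv> kolmogorov.lim"

lemma measurable_coordinate [measurable]: "0 \<le> t \<Longrightarrow> (\<lambda>\<omega>. \<omega> t) \<in> borel_measurable path_space"
  by (subst measurable_cong_sets[OF kolmogorov.sets_lim refl]) (auto intro: measurable_component_singleton)

lemma distr_path_space: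
  assumes "finite J" "J \<subseteq> {0..}"
  shows "distr path_space (\<Pi>\<^sub>M t\<in>J. borel) (\<lambda>\<omega>. restrict \<omega> J) = fdd J"
proof (rule measure_eqI)
  show "sets (distr path_space (\<Pi>\<^sub>M t\<in>J. borel) (\<lambda>\<omega>. restrict \<omega> J)) = sets (fdd J)"
    by (simp add: fdd_def)
next
  fix A assume A: "A \<in> sets (distr path_space (\<Pi>\<^sub>M t\<in>J. borel) (\<lambda>\<omega>. restrict \<omega> J))"
  have "(\<lambda>\<omega>. restrict \<omega> J) \<in> measurable path_space (\<Pi>\<^sub>M t\<in>J. borel)"
    using assms by (subst measurable_cong_sets[OF kolmogorov.sets_lim refl]) (auto intro: measurable_restrict_subset)
  then show "emeasure (distr path_space (\<Pi>\<^sub>M t\<in>J. borel) (\<lambda>\<omega>. restrict \<omega> J)) A = emeasure (fdd J) A"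
    using A assms kolmogorov.emeasure_lim_emb[of J A]
    by (simp add: emeasure_distr prod_emb_def space_PiM)
qed

lemma indep_vars_path_increments:
  assumes \<tau>: "0 \<le> \<tau> 0" "\<And>i. i < m \<Longrightarrow> \<tau> i \<le> \<tau> (Suc i)"
  shows "kolmogorov.P.indep_vars (\<lambda>_. borel) (\<lambda>i \<omega>. \<omega> (\<tau> (Suc i)) - \<omega> (\<tau> i)) {..<m}"
proof -
  define J where "J = \<tau> ` {..m}"
  have mono: "\<tau> i \<le> \<tau> j" if "i \<le> j" "j \<le> m" for i j
    using that by (induction j rule: dec_induct) (auto intro: order_trans[OF _ \<tau>(2)])
  have nonneg: "0 \<le> \<tau> i" if "i \<le> m" for i
    using mono[of 0 i] \<tau>(1) that by simp
  have J: "finite J" "J \<subseteq> {0..}"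
    using nonneg by (auto simp: J_def)
  interpret N: prob_space "increments J" by (rule prob_space_increments[OF J])
  have "N.indep_vars (\<lambda>_. borel) (\<lambda>i z. \<Sum>s\<in>J \<inter> {\<tau> i<..\<tau> (Suc i)}. z s) {..<m}"
  proof (rule indep_vars_block_sums[OF J])
    show "disjoint_family_on (\<lambda>i. J \<inter> {\<tau> i<..\<tau> (Suc i)}) {..<m}"
      unfolding disjoint_family_on_def
    proof (intro ballI impI)
      fix i j assume "i \<in> {..<m}" "j \<in> {..<m}" "i \<noteq> j"
      then show "J \<inter> {\<tau> i<..\<tau> (Suc i)} \<inter> (J \<inter> {\<tau> j<..\<tau> (Suc j)}) = {}"
        using mono[of "Suc i" j] mono[of "Suc j" i] by (cases i j rule: linorder_cases) auto
    qed
  qed auto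
  also have "?this \<longleftrightarrow> N.indep_vars (\<lambda>_. borel)
      (\<lambda>i z. partial_sums J z (\<tau> (Suc i)) - partial_sums J z (\<tau> i)) {..<m}"
  proof (rule N.indep_vars_cong)
    fix i assume "i \<in> {..<m}"
    then have i: "i < m" "\<tau> i \<in> J" "\<tau> (Suc i) \<in> J"
      by (auto simp: J_def)
    show "(\<lambda>z. \<Sum>s\<in>J \<inter> {\<tau> i<..\<tau> (Suc i)}. z s)
        = (\<lambda>z. partial_sums J z (\<tau> (Suc i)) - partial_sums J z (\<tau> i))"
      using sum_Ioc_split[OF J(1) nonneg \<tau>(2)[OF i(1)]] i by (simp add: partial_sums_def)
  qed simp_all
  also have "\<dots> \<longleftrightarrow> prob_space.indep_vars (fdd J) (\<lambda>_. borel) (\<lambda>i f. f (\<tau> (Suc i)) - f (\<tau> i)) {..<m}"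
    unfolding fdd_def
  proof (rule N.indep_vars_distr[symmetric])
    show "partial_sums J \<in> measurable (increments J) (\<Pi>\<^sub>M t\<in>J. borel)"
      by (rule measurable_partial_sums[OF J])
  qed (auto intro!: borel_measurable_diff measurable_component_singleton simp: J_def)
  also have "\<dots> \<longleftrightarrow> kolmogorov.P.indep_vars (\<lambda>_. borel)
      (\<lambda>i \<omega>. restrict \<omega> J (\<tau> (Suc i)) - restrict \<omega> J (\<tau> i)) {..<m}"
    unfolding distr_path_space[OF J, symmetric]
  proof (rule kolmogorov.P.indep_vars_distr)
    show "(\<lambda>\<omega>. restrict \<omega> J) \<in> measurable path_space (\<Pi>\<^sub>M t\<in>J. borel)"
      using J by (subst measurable_cong_sets[OF kolmogorov.sets_lim refl]) (auto intro: measurable_restrict_subset)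
  qed (auto intro!: borel_measurable_diff measurable_component_singleton simp: J_def)
  also have "\<dots> \<longleftrightarrow> ?thesis"
    by (rule kolmogorov.P.indep_vars_cong) (auto simp: J_def)
  finally show ?thesis .
qed

lemma distr_path_increment:
  assumes st: "0 \<le> s" "s \<le> t"
  shows "distr path_space borel (\<lambda>\<omega>. \<omega> t - \<omega> s) = \<mu> (t - s)"
proof -
  let ?J = "{s, t}"
  have J: "finite ?J" "?J \<subseteq> {0..}" using st by auto
  have [measurable]: "(\<lambda>\<omega>. restrict \<omega> ?J) \<in> measurable path_space (\<Pi>\<^sub>M t\<in>?J. borel)"
    using J by (subst measurable_cong_sets[OF kolmogorov.sets_lim refl]) (auto intro: measurable_restrict_subset)
  have [measurable]: "(\<lambda>f. f t - f s) \<in> borel_measurable (\<Pi>\<^sub>M t\<in>?J. (borel :: real measure))"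
    by (intro borel_measurable_diff measurable_component_singleton) auto
  have "distr path_space borel (\<lambda>\<omega>. \<omega> t - \<omega> s)
      = distr (distr path_space (\<Pi>\<^sub>M t\<in>?J. borel) (\<lambda>\<omega>. restrict \<omega> ?J)) borel (\<lambda>f. f t - f s)"
    by (subst distr_distr) (auto simp: comp_def)
  also have "\<dots> = distr (increments ?J) borel (\<lambda>z. partial_sums ?J z t - partial_sums ?J z s)"
    unfolding distr_path_space[OF J] fdd_def
    using measurable_partial_sums[OF J] by (subst distr_distr) (auto simp: comp_def)
  also have "(\<lambda>z. partial_sums ?J z t - partial_sums ?J z s) = (\<lambda>z. \<Sum>u\<in>?J \<inter> {s<..t}. z u)"
    using st by (subst sum_Ioc_split) (auto simp: fun_eq_iff partial_sums_def)
  also have "distr (increments ?J) borel \<dots> = \<mu> (t - s)"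
    using st by (intro distr_interval_sum J) auto
  finally show ?thesis .
qed

lemma initial_law: "\<mu> 0 = return borel 0"
proof (rule Levy_uniqueness)
  show "real_distribution (return borel (0::real))"
    by (simp add: real_distribution_def real_distribution_axioms_def prob_space_return)
  show "char (\<mu> 0) = char (return borel 0)"
  proof
    fix \<xi>
    have "char (return borel 0) \<xi> = 1"
      unfolding char_def by (subst integral_return) auto
    then show "char (\<mu> 0) \<xi> = char (return borel 0) \<xi>"
      by (simp add: char_eq)
  qed
qed (simp add: distribution)

lemma path_starts_at_zero: "AE \<omega> in path_space. \<omega> 0 = 0"
proof -
  let ?J = "{0 :: real}"
  have J: "finite ?J" "?J \<subseteq> {0..}" by auto
  have [measurable]: "(\<lambda>\<omega>. restrict \<omega> ?J) \<in> measurable path_space (\<Pi>\<^sub>M t\<in>?J. borel)"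
    using J by (subst measurable_cong_sets[OF kolmogorov.sets_lim refl]) (auto intro: measurable_restrict_subset)
  have "AE z in increments ?J. partial_sums ?J z 0 = 0"
    by (simp add: partial_sums_def)
  then have "AE f in fdd ?J. f 0 = 0"
    unfolding fdd_def using measurable_partial_sums[OF J] by (subst AE_distr_iff) auto
  then have "AE \<omega> in path_space. restrict \<omega> ?J 0 = 0"
    unfolding distr_path_space[OF J, symmetric] by (subst (asm) AE_distr_iff) auto
  then show ?thesis by simp
qed

lemma distr_path_coordinate:
  assumes "0 \<le> t"
  shows "distr path_space borel (\<lambda>\<omega>. \<omega> t) = \<mu> t"
proof -
  have "distr path_space borel (\<lambda>\<omega>. \<omega> t) = distr path_space borel (\<lambda>\<omega>. \<omega> t - \<omega> 0)"
    using path_starts_at_zero assms by (intro distr_cong_AE) auto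
  then show ?thesis
    using distr_path_increment[of 0 t] assms by simp
qed

text \<open>
  Continuity in probability at time 0: the characteristic functions converge to 1 as \<open>h\<close> tends to 0, so \<open>\<mu> h\<close>
  converges weakly to the point mass at 0.
\<close>

lemma tail_tendsto_0:
  assumes \<delta>: "0 < \<delta>"
  shows "((\<lambda>h. measure (\<mu> h) {x. \<bar>x\<bar> > \<delta>}) \<longlongrightarrow> 0) (at 0 within {0..})"
  unfolding tendsto_at_iff_sequentially
proof (intro allI impI)
  fix h :: "nat \<Rightarrow> real" assume h: "\<forall>i. h i \<in> {0..} - {0}" "h \<longlonglongrightarrow> 0"
  have "weak_conv_m (\<lambda>n. \<mu> (h n)) (\<mu> 0)"
  proof (rule levy_continuity)
    fix \<xi>
    have "(\<lambda>n. exp (- (complex_of_real (h n) * \<psi> \<xi>))) \<longlonglongrightarrow> exp (- (complex_of_real 0 * \<psi> \<xi>))"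
      by (intro tendsto_intros h)
    then show "(\<lambda>n. char (\<mu> (h n)) \<xi>) \<longlonglongrightarrow> char (\<mu> 0) \<xi>"
      using h by (simp add: char_eq)
  qed (use h distribution in auto)
  moreover have "frontier {x. \<bar>x\<bar> > \<delta>} \<subseteq> - {0}"
  proof -
    have "{x. \<bar>x\<bar> > \<delta>} = - cball 0 \<delta>" by auto
    then have "frontier {x. \<bar>x\<bar> > \<delta>} = frontier (cball 0 \<delta>)"
      by (simp only: frontier_complement)
    then show ?thesis using \<delta> by (auto simp: frontier_cball)
  qed
  then have "emeasure (\<mu> 0) (frontier {x. \<bar>x\<bar> > \<delta>}) = 0"
    by (auto simp: initial_law indicator_def)
  ultimately have "(\<lambda>n. measure (\<mu> (h n)) {x. \<bar>x\<bar> > \<delta>}) \<longlonglongrightarrow> measure (\<mu> 0) {x. \<bar>x\<bar> > \<delta>}"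
    using h by (intro weak_conv_imp_continuity_set_conv distribution) auto
  then show "((\<lambda>h. measure (\<mu> h) {x. \<bar>x\<bar> > \<delta>}) \<circ> h) \<longlonglongrightarrow> 0"
    using \<delta> by (simp add: comp_def initial_law measure_return)
qed

end

lemma (in convolution_semigroup) levy_process_path_space: "levy_process path_space (\<lambda>t \<omega>. \<omega> t)"
proof
  show "AE \<omega> in path_space. \<omega> 0 = 0"
    by (rule path_starts_at_zero)
next
  fix s t :: real assume "0 \<le> s" "s \<le> t"
  then show "distr path_space borel (\<lambda>\<omega>. \<omega> t - \<omega> s) = distr path_space borel (\<lambda>\<omega>. \<omega> (t - s))"
    by (simp add: distr_path_increment distr_path_coordinate)
next
  fix s \<delta> :: real assume s: "0 \<le> s" and \<delta>: "0 < \<delta>"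
  have law: "kolmogorov.P.prob {\<omega> \<in> space path_space. \<bar>\<omega> t - \<omega> s\<bar> > \<delta>}
      = measure (\<mu> \<bar>t - s\<bar>) {x. \<bar>x\<bar> > \<delta>}" if "0 \<le> t" for t
  proof -
    \<comment> \<open>Stationarity speaks of \<open>s \<le> t\<close> only, but \<open>t\<close> approaches \<open>s\<close> from both sides.\<close>
    define a b where "a = min s t" and "b = max s t"
    have ab: "0 \<le> a" "a \<le> b" "\<bar>t - s\<bar> = b - a"
      using s that by (auto simp: a_def b_def)
    have [measurable]: "(\<lambda>\<omega>. \<omega> b - \<omega> a) \<in> borel_measurable path_space"
      using ab by (intro borel_measurable_diff measurable_coordinate) auto
    have "measure (\<mu> \<bar>t - s\<bar>) {x. \<bar>x\<bar> > \<delta>}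
        = measure (distr path_space borel (\<lambda>\<omega>. \<omega> b - \<omega> a)) {x. \<bar>x\<bar> > \<delta>}"
      using ab by (simp add: distr_path_increment)
    also have "\<dots> = kolmogorov.P.prob {\<omega> \<in> space path_space. \<bar>\<omega> b - \<omega> a\<bar> > \<delta>}"
      by (subst measure_distr) (auto simp: vimage_def Int_def conj_commute)
    also have "{\<omega> \<in> space path_space. \<bar>\<omega> b - \<omega> a\<bar> > \<delta>} = {\<omega> \<in> space path_space. \<bar>\<omega> t - \<omega> s\<bar> > \<delta>}"
      by (auto simp: a_def b_def min_def max_def abs_minus_commute)
    finally show ?thesis by simp
  qed
  have "filterlim (\<lambda>t. \<bar>t - s\<bar>) (at 0 within {0..}) (at s within {0..})"
    unfolding filterlim_at by (auto intro!: tendsto_eq_intros simp: eventually_at_filter)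
  then have "((\<lambda>t. measure (\<mu> \<bar>t - s\<bar>) {x. \<bar>x\<bar> > \<delta>}) \<longlongrightarrow> 0) (at s within {0..})"
    by (rule filterlim_compose[OF tail_tendsto_0[OF \<delta>]])
  moreover have "\<forall>\<^sub>F t in at s within {0..}. measure (\<mu> \<bar>t - s\<bar>) {x. \<bar>x\<bar> > \<delta>}
      = kolmogorov.P.prob {\<omega> \<in> space path_space. \<bar>\<omega> t - \<omega> s\<bar> > \<delta>}"
    unfolding eventually_at_filter by (intro always_eventually allI impI) (simp only: law atLeast_iff)
  ultimately show "((\<lambda>t. kolmogorov.P.prob {\<omega> \<in> space path_space. \<bar>\<omega> t - \<omega> s\<bar> > \<delta>}) \<longlongrightarrow> 0)
      (at s within {0..})"
    by (rule Lim_transform_eventually)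
next
  fix m :: nat and \<tau> :: "nat \<Rightarrow> real"
  assume "0 \<le> \<tau> 0" "\<And>i. i < m \<Longrightarrow> \<tau> i \<le> \<tau> (Suc i)"
  then show "kolmogorov.P.indep_vars (\<lambda>_. borel) (\<lambda>i \<omega>. \<omega> (\<tau> (Suc i)) - \<omega> (\<tau> i)) {..<m}"
    by (rule indep_vars_path_increments)
qed (rule measurable_coordinate)

lemma (in convolution_semigroup) is_levy_symbol_path_space:
  "is_levy_symbol path_space (\<lambda>t \<omega>. \<omega> t) \<psi>"
  by (simp add: is_levy_symbol_def distr_path_coordinate char_eq)

section \<open>The process with a given concave symbol\<close>

lemma ex_levy_process:
  assumes f: "smooth_concave f" "(f \<longlongrightarrow> 0) (at_right 0)" "filterlim f at_top at_top" "f 0 = 0"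
  shows "\<exists>(M :: (real \<Rightarrow> real) measure) (X :: real \<Rightarrow> (real \<Rightarrow> real) \<Rightarrow> real).
           levy_process M X \<and>
           is_levy_symbol M X (\<lambda>\<xi>. complex_of_real (f \<bar>\<xi>\<bar>)) \<and>
           (\<exists>p. is_transition_density M X p)"
proof -
  obtain p where p: "\<And>t x. 0 < t \<Longrightarrow> 0 \<le> p t x"
      "\<And>t. 0 < t \<Longrightarrow> p t \<in> borel_measurable borel"
      "\<And>t. 0 < t \<Longrightarrow> real_distribution (density lborel (\<lambda>x. ennreal (p t x)))"
      "\<And>t \<xi>. 0 < t \<Longrightarrow> char (density lborel (\<lambda>x. ennreal (p t x))) \<xi> = complex_of_real (exp (- (t * f \<bar>\<xi>\<bar>)))"
    using ex_polya_semigroup[OF f] by blast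
  define \<mu> where "\<mu> t = (if t = 0 then return borel 0 else density lborel (\<lambda>x. ennreal (p t x)))" for t
  have zero: "real_distribution (return borel (0::real))"
    by (simp add: real_distribution_def real_distribution_axioms_def prob_space_return)
  have char_zero: "char (return borel 0) \<xi> = 1" for \<xi>
    unfolding char_def by (subst integral_return) auto
  interpret convolution_semigroup \<mu> "\<lambda>\<xi>. complex_of_real (f \<bar>\<xi>\<bar>)"
  proof (rule convolution_semigroup.intro)
    fix t \<xi> :: real assume t: "0 \<le> t"
    show "real_distribution (\<mu> t)"
      using t zero p(3)[of t] by (simp add: \<mu>_def)
    have "exp (- (complex_of_real t * complex_of_real (f \<bar>\<xi>\<bar>))) = exp (complex_of_real (- (t * f \<bar>\<xi>\<bar>)))"
      by simp
    also have "\<dots> = complex_of_real (exp (- (t * f \<bar>\<xi>\<bar>)))"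
      by (rule exp_of_real)
    also have "\<dots> = char (\<mu> t) \<xi>"
      using t char_zero[of \<xi>] p(4)[of t \<xi>] by (cases "t = 0") (simp_all add: \<mu>_def)
    finally show "char (\<mu> t) \<xi> = exp (- (complex_of_real t * complex_of_real (f \<bar>\<xi>\<bar>)))"
      by simp
  qed
  have "is_transition_density path_space (\<lambda>t \<omega>. \<omega> t) p"
    unfolding is_transition_density_def distributed_def
  proof (intro allI impI conjI)
    fix t :: real assume t: "0 < t"
    show "0 \<le> p t x" for x
      by (rule p(1)[OF t])
    have "distr path_space lborel (\<lambda>\<omega>. \<omega> t) = distr path_space borel (\<lambda>\<omega>. \<omega> t)"
      by (rule distr_cong) auto
    also have "\<dots> = density lborel (\<lambda>x. ennreal (p t x))"
      using t by (simp add: distr_path_coordinate \<mu>_def)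
    finally show "distr path_space lborel (\<lambda>\<omega>. \<omega> t) = density lborel (\<lambda>x. ennreal (p t x))" .
    show "(\<lambda>x. ennreal (p t x)) \<in> borel_measurable lborel"
      using p(2)[OF t] by simp
    show "(\<lambda>\<omega>. \<omega> t) \<in> measurable path_space lborel"
      using measurable_coordinate[of t] t by simp
  qed
  then show ?thesis
    using levy_process_path_space is_levy_symbol_path_space by blast
qed

theorem mainTheorem3:
  fixes \<epsilon> :: real and n :: nat
  assumes "0 < \<epsilon>" and "\<epsilon> \<le> 1" and "n \<ge> 2"
  shows "\<exists>(M :: (real \<Rightarrow> real) measure) (X :: real \<Rightarrow> (real \<Rightarrow> real) \<Rightarrow> real).
           levy_process M X \<and>
           is_levy_symbol M X (\<lambda>\<xi>. complex_of_real (iter_log n \<xi> powr \<epsilon>)) \<and>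
           (\<exists>p. is_transition_density M X p)"
proof -
  define L :: "real \<Rightarrow> real" where "L = (\<lambda>y. ln (1 + y)) ^^ n"
  have L: "smooth_concave L" "(L \<longlongrightarrow> 0) (at_right 0)" "filterlim L at_top at_top"
    unfolding L_def by (rule smooth_concave_iterated_ln iterated_ln_tendsto_0 iterated_ln_at_top)+
  have "L 0 = 0"
    unfolding L_def by (induction n) simp_all
  have "smooth_concave (\<lambda>r. L r powr \<epsilon>)"
    by (rule smooth_concave_compose[OF smooth_concave_powr[OF assms(1,2)] L(1)])
  moreover have "((\<lambda>r. L r powr \<epsilon>) \<longlongrightarrow> 0 powr \<epsilon>) (at_right 0)"
  proof (rule tendsto_powr'[OF L(2) tendsto_const])
    have "\<forall>\<^sub>F r in at_right 0. 0 \<le> L r"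
      using L(1) unfolding smooth_concave_def eventually_at_filter
      by (auto intro!: always_eventually less_imp_le)
    then show "0 \<noteq> (0::real) \<or> 0 < \<epsilon> \<and> (\<forall>\<^sub>F r in at_right 0. 0 \<le> L r)"
      using assms(1) by simp
  qed
  moreover have "filterlim (\<lambda>r. L r powr \<epsilon>) at_top at_top"
  proof (rule filterlim_compose[OF _ L(3)])
    show "filterlim (\<lambda>x::real. x powr \<epsilon>) at_top at_top"
      using assms(1) by real_asymp
  qed
  ultimately show ?thesis
    using ex_levy_process[of "\<lambda>r. L r powr \<epsilon>"] \<open>L 0 = 0\<close>
    by (simp add: iter_log_eq L_def)
qed

end
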